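(* Let $\mathcal{A}$ be a real (linear or affine) hyperplane arrangement with associated oriented system $(\Gamma,\sim)$. For the identical cover $id:(\Gamma,\sim)\rightarrow(\Gamma,\sim)$, the homotopy colimit of the diagram $\mathscr{D}_{id}$ is homotopy equivalent to the Salvetti complex of $\mathcal{A}$: $$\mathrm{hocolim}\,\mathscr{D}_{id}\simeq Sal(\mathcal{A}).$$ In fact, the order complex $\Delta(\mathrm{Plim}\,\mathscr{D}_{id})$ of the poset limit of $\mathscr{D}_{id}$ is identical (isomorphic as a simplicial complex) with the Salvetti complex $Sal(\mathcal{A})$.
   Context: **Arrangements.** $\mathcal{A}$ is a finite set of linear or affine hyperplanes in $\mathbb{R}^d$. $\mathcal{F}=\mathcal{F}(\mathcal{A})$ is its face poset: the set of all relatively open polyhedral cells of the stratification of $\mathbb{R}^d$ induced by $\mathcal{A}$, ordered by $F_1\ge F_2 \iff \overline{F_1}\subseteq\overline{F_2}$. The chambers $\mathcal{C}(\mathcal{A})$ (components of $\mathbb{R}^d\setminus\bigcup\mathcal{A}$) are the minimal elements. $|F|$ is the affine hull of $F$, and $\mathcal{A}_{|F|}=\{H\in\mathcal{A}: |F|\subseteq H\}$. For a face $F$ and chamber $C$, $C_F$ is the unique chamber of $\mathcal{A}$ whose closure contains $F$ and which lies in the same chamber of $\mathcal{A}_{|F|}$ as $C$. **Salvetti complex.** Choose a point $w(F)$ in every face $F$ and put $w(F,C)=w(F)\oplus[w(F)-w(C_F)]\in\mathbb{R}^d\oplus\mathbb{R}^d=\mathbb{C}^d$ (it depends only on $F$ and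 $C_F$). $Sal(\mathcal{A})$ is the simplicial complex with vertices $w(F,C)$, $F\in\mathcal{F}$, $C\in\mathcal{C}(\mathcal{A})$, in which the convex hull of $w(F_0,C_0),\dots,w(F_k,C_k)$ is a simplex iff (up to ordering) $F_0>\dots>F_k$ is a chain in $\mathcal{F}$ and $(C_0)_{F_i}=(C_i)_{F_i}$ for all $i$. **Oriented system of $\mathcal{A}$.** $(\Gamma,\sim)$ is the oriented graph with vertex set $\mathcal{C}(\mathcal{A})$ and an edge $(A,B)$ for every ordered pair of adjacent chambers, with the equivalence relation on paths generated by identifying any two positive paths with the same ends that both have minimal length. For the identity cover the general construction of the diagram $\mathscr{D}_\rho$ attached to a cover $\rho$ reads as follows. **The diagram $\mathscr{D}_{id}$.** It is the diagram of spaces over $\mathcal{F}$ (covariant functor $\mathcal{F}\to Top$, with an arrow $F_1\to F_2$ iff $F_1\ge F_2$) with discrete spaces $\mathscr{D}_{id}(F)=\{C\in\mathcal{C}(\mathcal{A}): C\le F\}$ and maps $\mathscr{D}_{id}(F_1>F_2): C\mapsto C_{F_2}$ (the end of a positive minimal path in $\Gamma$ from $C$ to $C_{F_2}$). **Homotopy colimit.** For a diagram $\mathscr{D}$ over a poset $\mathcal{P}$ with spaces $D_p$ and maps $f_{p>q}$, $\mathrm{hocolim}\,\mathscr{D}=\bigsqcup_{p} D_p\times\Delta(\mathcal{P}_{\le p})/\!\sim$, where for $p>q$ each point $(x,t)\in D_p\times\Delta(\mathcal{P}_{\le q})\subseteq D_p\times\Delta(\mathcal{P}_{\le p})$ is identified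 with $(f_{p>q}(x),t)\in D_q\times\Delta(\mathcal{P}_{\le q})$. $\Delta(\cdot)$ denotes the order complex. **Poset limit.** $\mathrm{Plim}\,\mathscr{D}_{id}$ is the set of pairs $(F,C)$ with $F\in\mathcal{F}$, $C\in\mathscr{D}_{id}(F)$, ordered by $(F_1,C_1)\ge(F_2,C_2)$ iff $F_1\ge F_2$ and $(C_1)_{F_2}=C_2$. *)

theory Defs
  imports "HOL-Analysis.Analysis"
begin

section \<open>Hyperplane arrangements\<close>

definition hyperplane :: "'a::euclidean_space set \<Rightarrow> bool" where
  "hyperplane H \<longleftrightarrow> (\<exists>a b. a \<noteq> 0 \<and> H = {x. a \<bullet> x = b})"

definition arrangement :: "'a::euclidean_space set set \<Rightarrow> bool" where
  "arrangement \<A> \<longleftrightarrow> finite \<A> \<and> (\<forall>H\<in>\<A>. hyperplane H)"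

definition chambers :: "'a::euclidean_space set set \<Rightarrow> 'a set set" where
  "chambers \<A> = components (- \<Union>\<A>)"

text \<open>
  The stratum of a subset \<open>\<B>\<close> of \<open>\<A>\<close> consists of the points lying on exactly those hyperplanes of
  \<open>\<A>\<close> that belong to \<open>\<B>\<close> (where \<open>\<Inter>{} = UNIV\<close>); the cells are the connected components of the strata.
\<close>

definition faces :: "'a::euclidean_space set set \<Rightarrow> 'a set set" where
  "faces \<A> = (\<Union>\<B>\<in>Pow \<A>. components (\<Inter>\<B> - \<Union>(\<A> - \<B>)))"

text \<open>
  A pair \<open>(G, F)\<close> in an order relation means \<open>G \<le> F\<close>. The face order is reversed inclusion of
  closures, so that the chambers are the minimal faces.
\<close>

definition face_order :: "'a::euclidean_space set set \<Rightarrow> 'a set rel" where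
  "face_order \<A> = {(G, F). G \<in> faces \<A> \<and> F \<in> faces \<A> \<and> closure F \<subseteq> closure G}"

definition local_arrangement :: "'a::euclidean_space set set \<Rightarrow> 'a set \<Rightarrow> 'a set set" where
  "local_arrangement \<A> F = {H \<in> \<A>. affine hull F \<subseteq> H}"

text \<open>\<open>chamber_at \<A> C F\<close> is the chamber written \<open>C\<^sub>F\<close>.\<close>

definition chamber_at :: "'a::euclidean_space set set \<Rightarrow> 'a set \<Rightarrow> 'a set \<Rightarrow> 'a set" where
  "chamber_at \<A> C F =
     (THE D. D \<in> chambers \<A> \<and> F \<subseteq> closure D \<and>
             (\<exists>E \<in> chambers (local_arrangement \<A> F). C \<subseteq> E \<and> D \<subseteq> E))"

section \<open>Simplicial complexes\<close>

text \<open>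
  A simplicial complex is given by the set of (the vertex sets of) its nonempty simplices.
\<close>

definition simplicially_isomorphic :: "'v set set \<Rightarrow> 'w set set \<Rightarrow> bool" where
  "simplicially_isomorphic K L \<longleftrightarrow>
     (\<exists>f. bij_betw f (\<Union>K) (\<Union>L) \<and> (\<forall>\<sigma>. \<sigma> \<subseteq> \<Union>K \<longrightarrow> (\<sigma> \<in> K \<longleftrightarrow> f ` \<sigma> \<in> L)))"

definition order_complex :: "'p rel \<Rightarrow> 'p set set" where
  "order_complex r = {\<sigma> \<in> Chains r. finite \<sigma> \<and> \<sigma> \<noteq> {}}"

text \<open>
  Points of the geometric realization are given by their barycentric coordinates. The topology is
  that of pointwise convergence, which for finite complexes (the only ones considered here) is the
  usual weak topology.
\<close>

definition realization :: "'v set set \<Rightarrow> ('v \<Rightarrow> real) topology" where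
  "realization K =
     top_of_set {t. (\<forall>v. 0 \<le> t v) \<and> {v. t v \<noteq> 0} \<in> K \<and> (\<Sum>v | t v \<noteq> 0. t v) = 1}"

section \<open>Diagrams of spaces over a poset\<close>

text \<open>
  A diagram over a poset \<open>r\<close> (with carrier \<open>Field r\<close>) consists of spaces \<open>X p\<close> and of maps
  \<open>f p q\<close> from \<open>X p\<close> to \<open>X q\<close> for \<open>q \<le> p\<close>.
\<close>

definition quotient_topology :: "'a topology \<Rightarrow> 'a rel \<Rightarrow> 'a set topology" where
  "quotient_topology T R = topology (\<lambda>\<U>. \<U> \<subseteq> topspace T // R \<and> openin T (\<Union>\<U>))"

lemma openin_quotient_topology:
  assumes "equiv (topspace T) R"
  shows "openin (quotient_topology T R) \<U> \<longleftrightarrow> \<U> \<subseteq> topspace T // R \<and> openin T (\<Union>\<U>)"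
proof -
  have Int: "\<Union>(\<U> \<inter> \<V>) = \<Union>\<U> \<inter> \<Union>\<V>"
    if "\<U> \<subseteq> topspace T // R" "\<V> \<subseteq> topspace T // R" for \<U> \<V>
    using that quotient_disj[OF assms] by blast
  have Un: "\<Union>(\<Union>\<K>) = \<Union>(Union ` \<K>)" for \<K> :: "'a set set set"
    by blast
  have "istopology (\<lambda>\<U>. \<U> \<subseteq> topspace T // R \<and> openin T (\<Union>\<U>))"
    unfolding istopology_def by (auto simp: Int Un simp del: Union_iff)
  then show ?thesis
    by (simp add: quotient_topology_def)
qed

definition hocolim_sum ::
  "'p rel \<Rightarrow> ('p \<Rightarrow> 'x topology) \<Rightarrow> ('p \<times> 'x \<times> ('p \<Rightarrow> real)) topology" where
  "hocolim_sum r X =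
     sum_topology (\<lambda>p. prod_topology (X p) (realization (order_complex (Restr r (under r p)))))
       (Field r)"

definition hocolim_glue ::
  "'p rel \<Rightarrow> ('p \<Rightarrow> 'x topology) \<Rightarrow> ('p \<Rightarrow> 'p \<Rightarrow> 'x \<Rightarrow> 'x) \<Rightarrow>
     'p \<times> 'x \<times> ('p \<Rightarrow> real) \<Rightarrow> 'p \<times> 'x \<times> ('p \<Rightarrow> real) \<Rightarrow> bool" where
  "hocolim_glue r X f a b \<longleftrightarrow>
     (\<exists>p q x t. (q, p) \<in> r \<and> q \<noteq> p \<and> x \<in> topspace (X p) \<and>
        t \<in> topspace (realization (order_complex (Restr r (under r q)))) \<and>
        a = (p, x, t) \<and> b = (q, f p q x, t))"

definition hocolim ::
  "'p rel \<Rightarrow> ('p \<Rightarrow> 'x topology) \<Rightarrow> ('p \<Rightarrow> 'p \<Rightarrow> 'x \<Rightarrow> 'x) \<Rightarrow>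
     ('p \<times> 'x \<times> ('p \<Rightarrow> real)) set topology" where
  "hocolim r X f =
     quotient_topology (hocolim_sum r X)
       {(a, b). a \<in> topspace (hocolim_sum r X) \<and> b \<in> topspace (hocolim_sum r X) \<and>
                equivclp (hocolim_glue r X f) a b}"

text \<open>Here \<open>f p p\<close> has to be the identity on \<open>X p\<close> for the relation to be reflexive.\<close>

definition Plim ::
  "'p rel \<Rightarrow> ('p \<Rightarrow> 'x topology) \<Rightarrow> ('p \<Rightarrow> 'p \<Rightarrow> 'x \<Rightarrow> 'x) \<Rightarrow> ('p \<times> 'x) rel" where
  "Plim r X f =
     {((q, y), (p, x)). (q, p) \<in> r \<and> x \<in> topspace (X p) \<and> y \<in> topspace (X q) \<and> f p q x = y}"

text \<open>
  The diagram of the identity cover: its vertices over \<open>F\<close> are the vertices of the oriented graph,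
  i.e. the chambers, below \<open>F\<close>.
\<close>

definition D_id_space :: "'a::euclidean_space set set \<Rightarrow> 'a set \<Rightarrow> 'a set topology" where
  "D_id_space \<A> F = discrete_topology {C \<in> chambers \<A>. (C, F) \<in> face_order \<A>}"

definition D_id_map ::
  "'a::euclidean_space set set \<Rightarrow> 'a set \<Rightarrow> 'a set \<Rightarrow> 'a set \<Rightarrow> 'a set" where
  "D_id_map \<A> F G C = chamber_at \<A> C G"

section \<open>The Salvetti complex\<close>

text \<open>The complexification is represented as the product of the real and the imaginary part.\<close>

definition salvetti_vertex ::
  "'a::euclidean_space set set \<Rightarrow> ('a set \<Rightarrow> 'a) \<Rightarrow> 'a set \<Rightarrow> 'a set \<Rightarrow> 'a \<times> 'a" where
  "salvetti_vertex \<A> w F C = (w F, w F - w (chamber_at \<A> C F))"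

definition Sal ::
  "'a::euclidean_space set set \<Rightarrow> ('a set \<Rightarrow> 'a) \<Rightarrow> ('a \<times> 'a) set set" where
  "Sal \<A> w =
     {(\<lambda>i. salvetti_vertex \<A> w (F i) (C i)) ` {..k} | F C (k::nat).
        (\<forall>i\<le>k. F i \<in> faces \<A> \<and> C i \<in> chambers \<A>) \<and>
        (\<forall>i<k. (F (Suc i), F i) \<in> face_order \<A> \<and> F (Suc i) \<noteq> F i) \<and>
        (\<forall>i\<le>k. chamber_at \<A> (C 0) (F i) = chamber_at \<A> (C i) (F i))}"

definition Sal_space ::
  "'a::euclidean_space set set \<Rightarrow> ('a set \<Rightarrow> 'a) \<Rightarrow> ('a \<times> 'a) topology" where
  "Sal_space \<A> w = top_of_set (\<Union>\<sigma>\<in>Sal \<A> w. convex hull \<sigma>)"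

end

theory Submission
  imports Defs
begin

text \<open>
  Sending \<open>(p, C, t)\<close> to the combination with coefficients \<open>t\<close> of the vertices \<open>w(q, C)\<close> maps the compact
  space underlying the homotopy colimit continuously onto the Hausdorff space \<open>Sal(\<A>)\<close>, so it is a
  quotient map, and it suffices that its fibres are the gluing classes; the two spaces are then even
  homeomorphic. The real part of the image determines \<open>t\<close>, because a combination of the points \<open>w q\<close>
  along a chain lies in the smallest face involved. Given \<open>t\<close>, the imaginary part determines the
  chambers \<open>C\<^sub>q\<close>, starting from the smallest face, because all of them lie on the same side of the
  hyperplanes through that face.
\<close>

section \<open>Sign cells\<close>

text \<open>Signs replace polyhedral geometry throughout. A face is the set of points with a given
  sign vector, the face order is a coordinatewise condition on sign vectors, and
  \<open>C\<^sub>F\<close> is the sign vector of F with its zeros filled in from C, the composition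
  of covectors known from oriented matroids. The points \<open>w F\<close> are arbitrary within
  their faces, so uniqueness of coordinates, within one simplex and across different ones, has to
  come from signs. The single source is that a nonnegative combination of numbers whose signs never
  oppose the sign of one term of positive weight keeps that sign. The imaginary part is the delicate
  one: on a hyperplane that contains only some faces of a chain, the chambers over different faces
  may have opposite signs and cancel. Only hyperplanes through the smallest face are safe, so the
  chambers can be compared only at the smallest face where they might differ.\<close>

definition normal :: "'a::euclidean_space set \<Rightarrow> 'a" where
  "normal H = (SOME a. \<exists>b. a \<noteq> 0 \<and> H = {x. a \<bullet> x = b})"

definition offset :: "'a::euclidean_space set \<Rightarrow> real" where
  "offset H = (SOME b. H = {x. normal H \<bullet> x = b})"

definition level :: "'a::euclidean_space set \<Rightarrow> 'a \<Rightarrow> real" where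
  "level H x = normal H \<bullet> x - offset H"

text \<open>Which side counts as positive depends on the choice made in \<open>normal\<close>; only
  signs with respect to the same hyperplane are ever compared.\<close>

definition side :: "'a::euclidean_space set \<Rightarrow> 'a \<Rightarrow> real" where
  "side H x = sgn (level H x)"

definition cell :: "'a::euclidean_space set set \<Rightarrow> 'a \<Rightarrow> 'a set" where
  "cell \<A> x = {y. \<forall>H\<in>\<A>. side H y = side H x}"

lemma hyperplane_eq:
  assumes "hyperplane H"
  shows "H = {x. normal H \<bullet> x = offset H}"
proof -
  have "\<exists>a b. a \<noteq> 0 \<and> H = {x. a \<bullet> x = b}"
    using assms by (simp add: hyperplane_def)
  then have "\<exists>b. normal H \<noteq> 0 \<and> H = {x. normal H \<bullet> x = b}"
    unfolding normal_def by (rule someI_ex)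
  then have "\<exists>b. H = {x. normal H \<bullet> x = b}"
    by blast
  then show ?thesis
    unfolding offset_def by (rule someI_ex)
qed

lemma side_eq_0_iff: "hyperplane H \<Longrightarrow> side H x = 0 \<longleftrightarrow> x \<in> H"
  using hyperplane_eq[of H] by (auto simp: side_def level_def sgn_zero_iff)

lemma level_convex_comb:
  "u + v = 1 \<Longrightarrow> level H (u *\<^sub>R x + v *\<^sub>R y) = u * level H x + v * level H y"
proof -
  assume "u + v = 1"
  then have "offset H = u * offset H + v * offset H"
    by (simp flip: distrib_right)
  then show ?thesis
    by (simp add: level_def inner_add_right right_diff_distrib)
qed

text \<open>The offset is weighted by the total \<open>sum c I\<close>, which may differ from 1: the
  identity is later applied to differences of barycentric coordinates.\<close>

lemma level_sum: "(\<Sum>i\<in>I. c i * level H (f i)) = normal H \<bullet> (\<Sum>i\<in>I. c i *\<^sub>R f i) - sum c I * offset H"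
  by (simp add: level_def inner_sum_right right_diff_distrib sum_subtractf sum_distrib_right)

text \<open>The second summand is zero or has the sign of the first, so nothing cancels; for
  \<open>s = 0\<close> both summands vanish.\<close>

lemma sgn_add_weighted:
  fixes s :: real
  assumes "0 < u" "0 \<le> v" "sgn a = s" "v = 0 \<or> sgn b = 0 \<or> sgn b = s"
  shows "sgn (u * a + v * b) = s"
proof -
  consider "0 < a" "0 \<le> v * b" "s = 1" | "a < 0" "v * b \<le> 0" "s = - 1" | "a = 0" "v * b = 0" "s = 0"
    using assms by (auto simp: sgn_if mult_nonneg_nonpos split: if_splits)
  then show ?thesis
  proof cases
    case 1
    then have "0 < u * a + v * b"
      using assms(1) by (simp add: add_pos_nonneg)
    then show ?thesis
      using 1 by simp
  next
    case 2
    then have "u * a + v * b < 0"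
      using assms(1) by (simp add: add_neg_nonpos mult_pos_neg)
    then show ?thesis
      using 2 by simp
  next
    case 3
    show ?thesis
      unfolding 3 by simp
  qed
qed

lemma sgn_weighted_sum:
  fixes s :: real
  assumes "finite I" "\<And>i. i \<in> I \<Longrightarrow> 0 \<le> c i"
    and "\<And>i. i \<in> I \<Longrightarrow> c i \<noteq> 0 \<Longrightarrow> sgn (f i) = 0 \<or> sgn (f i) = s"
    and j: "j \<in> I" "0 < c j" "sgn (f j) = s"
  shows "sgn (\<Sum>i\<in>I. c i * f i) = s"
proof -
  define b where "b = (\<Sum>i\<in>I - {j}. c i * f i)"
  \<comment> \<open>Multiplying by s treats both signs at once. For \<open>s = 0\<close> the product
    says nothing, hence the second conjunct.\<close>
  have "0 \<le> s * (c i * f i) \<and> (s = 0 \<longrightarrow> c i * f i = 0)" if "i \<in> I" for i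
    using assms(2,3)[OF that] by (cases "c i = 0") (auto simp: sgn_if mult_nonneg_nonpos split: if_splits)
  then have "0 \<le> s * b" "s = 0 \<Longrightarrow> b = 0"
    unfolding b_def by (auto simp: sum_distrib_left intro!: sum_nonneg sum.neutral)
  then have "sgn b = 0 \<or> sgn b = s"
    using j(3) by (auto simp: sgn_if zero_le_mult_iff split: if_splits)
  then have "sgn (c j * f j + 1 * b) = s"
    using j by (intro sgn_add_weighted) auto
  then show ?thesis
    using assms(1) j(1) by (simp add: b_def sum.remove[of I j])
qed

lemma convex_cell: "convex (cell \<A> x)"
proof (rule convexI)
  fix y z and u v :: real
  assume *: "y \<in> cell \<A> x" "z \<in> cell \<A> x" "0 \<le> u" "0 \<le> v" "u + v = 1"
  show "u *\<^sub>R y + v *\<^sub>R z \<in> cell \<A> x"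
  proof (cases "u = 0")
    case False
    then show ?thesis
      using * by (auto simp: cell_def side_def level_convex_comb intro!: sgn_add_weighted)
  qed (use * in auto)
qed

text \<open>A cell is convex, hence connected, and stays in the stratum of its points. Conversely, a
  connected set that avoids a hyperplane cannot change sides, by the intermediate value
  theorem.\<close>

lemma stratum_component:
  assumes "arrangement \<A>" "\<B> \<subseteq> \<A>" "x \<in> \<Inter>\<B> - \<Union>(\<A> - \<B>)"
  shows "connected_component_set (\<Inter>\<B> - \<Union>(\<A> - \<B>)) x = cell \<A> x" (is "connected_component_set ?S x = _")
proof
  have hyp: "hyperplane H" if "H \<in> \<A>" for H
    using assms(1) that by (simp add: arrangement_def)
  show "cell \<A> x \<subseteq> connected_component_set ?S x"
  proof (rule connected_component_maximal)
    have *: "H \<in> \<B> \<longleftrightarrow> y \<in> H" if "H \<in> \<A>" "y \<in> cell \<A> x" for y H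
    proof -
      have "H \<in> \<B> \<longleftrightarrow> x \<in> H"
        using assms(2,3) that by blast
      then show ?thesis
        using that by (simp add: cell_def side_eq_0_iff[OF hyp[OF that(1)], symmetric])
    qed
    show "cell \<A> x \<subseteq> ?S"
    proof
      fix y
      assume y: "y \<in> cell \<A> x"
      show "y \<in> ?S"
        using *[OF _ y] assms(2) by auto
    qed
    show "connected (cell \<A> x)"
      by (rule convex_connected[OF convex_cell])
    show "x \<in> cell \<A> x"
      by (simp add: cell_def)
  qed
  show "connected_component_set ?S x \<subseteq> cell \<A> x"
  proof
    fix y
    assume "y \<in> connected_component_set ?S x"
    then obtain T where T: "connected T" "T \<subseteq> ?S" "x \<in> T" "y \<in> T"
      by (auto simp: connected_component_def)
    have "side H y = side H x" if H: "H \<in> \<A>" for H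
    proof (cases "H \<in> \<B>")
      case True
      then have "x \<in> H" "y \<in> H"
        using T by blast+
      then show ?thesis
        using side_eq_0_iff[OF hyp[OF H]] by metis
    next
      case False
      then have "z \<notin> H" if "z \<in> T" for z
        using T H that by blast
      then have *: "normal H \<bullet> z \<noteq> offset H" if "z \<in> T" for z
        using hyperplane_eq[OF hyp[OF H]] that by blast
      have "\<not> (normal H \<bullet> x \<le> offset H \<and> offset H \<le> normal H \<bullet> y)"
        using connected_ivt_hyperplane[OF T(1,3,4)] * by blast
      moreover have "\<not> (normal H \<bullet> y \<le> offset H \<and> offset H \<le> normal H \<bullet> x)"
        using connected_ivt_hyperplane[OF T(1,4,3)] * by blast
      ultimately show ?thesis
        by (auto simp: side_def level_def sgn_if)
    qed
    then show "y \<in> cell \<A> x"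
      by (simp add: cell_def)
  qed
qed

lemma faces_eq_cells:
  assumes "arrangement \<A>"
  shows "faces \<A> = range (cell \<A>)"
proof -
  have "components (\<Inter>\<B> - \<Union>(\<A> - \<B>)) = cell \<A> ` (\<Inter>\<B> - \<Union>(\<A> - \<B>))" if "\<B> \<subseteq> \<A>" for \<B>
    unfolding components_def using stratum_component[OF assms that] by (intro image_cong) auto
  then have "faces \<A> = cell \<A> ` (\<Union>\<B>\<in>Pow \<A>. \<Inter>\<B> - \<Union>(\<A> - \<B>))"
    by (auto simp: faces_def)
  also have "(\<Union>\<B>\<in>Pow \<A>. \<Inter>\<B> - \<Union>(\<A> - \<B>)) = UNIV"
  proof -
    have "x \<in> (\<Union>\<B>\<in>Pow \<A>. \<Inter>\<B> - \<Union>(\<A> - \<B>))" for x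
      \<comment> \<open>Every point lies in the stratum of exactly those hyperplanes that pass
        through it.\<close>
      by (rule UN_I[of "{H \<in> \<A>. x \<in> H}"]) auto
    then show ?thesis
      by (rule UNIV_eq_I[symmetric])
  qed
  finally show ?thesis .
qed

lemma chambers_eq_cells:
  assumes "arrangement \<A>"
  shows "chambers \<A> = cell \<A> ` (- \<Union>\<A>)"
proof -
  have *: "\<Inter>{} - \<Union>(\<A> - {}) = - \<Union>\<A>"
    by (simp add: Compl_eq_Diff_UNIV)
  have "connected_component_set (- \<Union>\<A>) x = cell \<A> x" if "x \<in> - \<Union>\<A>" for x
    using stratum_component[OF assms, of "{}", unfolded *] that by simp
  then show ?thesis
    unfolding chambers_def components_def by (rule image_cong[OF refl])
qed

text \<open>The right-hand side is an intersection of hyperplanes and closed half-spaces.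
  Conversely, the open segment from such a y to x stays in the cell, because the signs of x
  dominate, and y is a limit of its points.\<close>

lemma closure_cell:
  assumes "arrangement \<A>"
  shows "closure (cell \<A> x) = {y. \<forall>H\<in>\<A>. side H y = 0 \<or> side H y = side H x}" (is "_ = ?W")
proof
  have "closed {y. side H y = 0 \<or> side H y = side H x}" for H
  proof -
    have "{y. side H y = 0 \<or> side H y = side H x} =
      (if level H x = 0 then {y. normal H \<bullet> y = offset H}
       else if level H x > 0 then {y. normal H \<bullet> y \<ge> offset H} else {y. normal H \<bullet> y \<le> offset H})"
      by (auto simp: side_def level_def sgn_if)
    then show ?thesis
      by (simp add: closed_hyperplane closed_halfspace_le closed_halfspace_ge)
  qed
  then have "closed (\<Inter>H\<in>\<A>. {y. side H y = 0 \<or> side H y = side H x})"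
    by blast
  moreover have "?W = (\<Inter>H\<in>\<A>. {y. side H y = 0 \<or> side H y = side H x})"
    by blast
  ultimately show "closure (cell \<A> x) \<subseteq> ?W"
    by (intro closure_minimal) (auto simp: cell_def)
  show "?W \<subseteq> closure (cell \<A> x)"
  proof
    fix y
    assume y: "y \<in> ?W"
    show "y \<in> closure (cell \<A> x)"
    proof (cases "y = x")
      case True
      then show ?thesis
        using closure_subset[of "cell \<A> x"] by (auto simp: cell_def)
    next
      case False
      have "open_segment y x \<subseteq> cell \<A> x"
      proof
        fix z
        assume "z \<in> open_segment y x"
        then obtain u where u: "0 < u" "u < 1" "z = u *\<^sub>R x + (1 - u) *\<^sub>R y"
          by (auto simp: in_segment add.commute)
        have "side H z = side H x" if "H \<in> \<A>" for H
          using u y that by (auto simp: side_def level_convex_comb intro!: sgn_add_weighted)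
        then show "z \<in> cell \<A> x"
          by (simp add: cell_def)
      qed
      then have "closure (open_segment y x) \<subseteq> closure (cell \<A> x)"
        by (rule closure_mono)
      then show ?thesis
        using False by auto
    qed
  qed
qed

section \<open>Faces, face order and chambers in terms of sign vectors\<close>

locale pointed_arrangement =
  fixes \<A> :: "'a::euclidean_space set set" and w :: "'a set \<Rightarrow> 'a"
  assumes arr: "arrangement \<A>" and w_in: "\<forall>F\<in>faces \<A>. w F \<in> F"
begin

text \<open>Signs are constant on a face, so the point chosen for the Salvetti complex also serves
  as the sample point at which the sign vector is read off.\<close>

lemma face_eq_cell:
  assumes "F \<in> faces \<A>"
  shows "F = cell \<A> (w F)"
proof -
  obtain x where "F = cell \<A> x"
    using assms faces_eq_cells[OF arr] by auto
  moreover have "w F \<in> F"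
    using w_in assms by blast
  ultimately show ?thesis
    by (auto simp: cell_def)
qed

lemma mem_face_iff: "F \<in> faces \<A> \<Longrightarrow> y \<in> F \<longleftrightarrow> (\<forall>H\<in>\<A>. side H y = side H (w F))"
  using arg_cong[OF face_eq_cell, of F "\<lambda>S. y \<in> S"] by (simp add: cell_def)

lemma cell_face: "cell \<A> x \<in> faces \<A>"
  by (simp add: faces_eq_cells[OF arr])

lemma w_cell: "H \<in> \<A> \<Longrightarrow> side H (w (cell \<A> x)) = side H x"
  using w_in[rule_format, OF cell_face] by (simp add: cell_def)

lemma faces_eqI:
  assumes "F \<in> faces \<A>" "G \<in> faces \<A>" "\<And>H. H \<in> \<A> \<Longrightarrow> side H (w F) = side H (w G)"
  shows "F = G"
  by (rule set_eqI) (simp add: mem_face_iff[OF assms(1)] mem_face_iff[OF assms(2)] assms(3))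

lemma w_inj: "inj_on w (faces \<A>)"
  by (rule inj_onI) (simp add: faces_eqI)

text \<open>A face is determined by its sign vector, and there are at most three signs for each of
  finitely many hyperplanes.\<close>

lemma finite_faces: "finite (faces \<A>)"
proof (rule inj_on_finite)
  show "inj_on (\<lambda>F. restrict (\<lambda>H. side H (w F)) \<A>) (faces \<A>)"
    by (rule inj_onI, rule faces_eqI) (simp_all, metis restrict_apply')
  show "(\<lambda>F. restrict (\<lambda>H. side H (w F)) \<A>) ` faces \<A> \<subseteq> PiE \<A> (\<lambda>_. {- 1, 0, 1})"
    by (auto simp: side_def sgn_if split: if_splits)
  show "finite (PiE \<A> (\<lambda>_. {- 1, 0, 1 :: real}))"
    using arr by (intro finite_PiE) (auto simp: arrangement_def)
qed

text \<open>The closure of G is given by the weak sign conditions of G, so the inclusion of closures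
  can be tested at the single point \<open>w F\<close>.\<close>

lemma face_order_iff:
  "(G, F) \<in> face_order \<A> \<longleftrightarrow> G \<in> faces \<A> \<and> F \<in> faces \<A> \<and>
     (\<forall>H\<in>\<A>. side H (w F) = 0 \<or> side H (w F) = side H (w G))"
proof (cases "G \<in> faces \<A> \<and> F \<in> faces \<A>")
  case True
  then have *: "closure G = {y. \<forall>H\<in>\<A>. side H y = 0 \<or> side H y = side H (w G)}"
    "closure F = {y. \<forall>H\<in>\<A>. side H y = 0 \<or> side H y = side H (w F)}"
    using face_eq_cell closure_cell[OF arr] by metis+
  have "w F \<in> closure F"
    using * by simp
  then show ?thesis
    using True unfolding face_order_def by (auto simp: *) metis
qed (auto simp: face_order_def)

lemma face_order_trans:
  "(a, b) \<in> face_order \<A> \<Longrightarrow> (b, c) \<in> face_order \<A> \<Longrightarrow> (a, c) \<in> face_order \<A>"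
  by (auto simp: face_order_def)

lemma face_order_refl: "F \<in> faces \<A> \<Longrightarrow> (F, F) \<in> face_order \<A>"
  by (simp add: face_order_def)

lemma chambers_iff: "C \<in> chambers \<A> \<longleftrightarrow> C \<in> faces \<A> \<and> (\<forall>H\<in>\<A>. side H (w C) \<noteq> 0)"
proof -
  have hyp: "hyperplane H" if "H \<in> \<A>" for H
    using arr that by (simp add: arrangement_def)
  show ?thesis
  proof
    assume "C \<in> chambers \<A>"
    then obtain x where "C = cell \<A> x" "x \<notin> \<Union>\<A>"
      by (auto simp: chambers_eq_cells[OF arr])
    then show "C \<in> faces \<A> \<and> (\<forall>H\<in>\<A>. side H (w C) \<noteq> 0)"
      using cell_face w_cell side_eq_0_iff[OF hyp] by auto
  next
    assume C: "C \<in> faces \<A> \<and> (\<forall>H\<in>\<A>. side H (w C) \<noteq> 0)"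
    then have "w C \<in> - \<Union>\<A>"
      using side_eq_0_iff[OF hyp] by auto
    then show "C \<in> chambers \<A>"
      using C face_eq_cell by (metis chambers_eq_cells[OF arr] imageI)
  qed
qed

lemma chamber_face: "C \<in> chambers \<A> \<Longrightarrow> C \<in> faces \<A>"
  by (simp add: chambers_iff)

section \<open>Local arrangements and the chambers \<open>C\<^sub>F\<close>\<close>

lemma local_arrangement_eq:
  assumes "F \<in> faces \<A>"
  shows "local_arrangement \<A> F = {H \<in> \<A>. side H (w F) = 0}"
proof -
  have "affine hull F \<subseteq> H \<longleftrightarrow> side H (w F) = 0" if H: "H \<in> \<A>" for H
  proof -
    have hyp: "hyperplane H"
      using arr H by (simp add: arrangement_def)
    then have "affine H"
      using affine_hyperplane hyperplane_eq by metis
    then have "affine hull F \<subseteq> H \<longleftrightarrow> F \<subseteq> H"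
      by (meson hull_minimal hull_subset subset_trans)
    also have "\<dots> \<longleftrightarrow> side H (w F) = 0"
      using mem_face_iff[OF assms] side_eq_0_iff[OF hyp] w_in assms H
      by (metis subset_iff)
    finally show ?thesis .
  qed
  then show ?thesis
    by (auto simp: local_arrangement_def)
qed

text \<open>The chamber \<open>C\<^sub>F\<close> is the one entered when leaving \<open>w F\<close> in the direction of \<open>w C\<close>.\<close>

lemma chamber_at_exists:
  assumes "C \<in> chambers \<A>" "F \<in> faces \<A>"
  shows "\<exists>D\<in>faces \<A>. \<forall>H\<in>\<A>. side H (w D) = (if side H (w F) = 0 then side H (w C) else side H (w F))"
proof -
  let ?x = "\<lambda>e::real. (1 - e) *\<^sub>R w F + e *\<^sub>R w C"
  let ?s = "\<lambda>H. if side H (w F) = 0 then side H (w C) else side H (w F)"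
  have lev: "level H (?x e) = (1 - e) * level H (w F) + e * level H (w C)" for H e
    by (rule level_convex_comb) simp
  have "\<forall>\<^sub>F e in at_right 0. side H (?x e) = ?s H" for H
  proof (cases "side H (w F) = 0")
    case True
    then have 0: "level H (w F) = 0"
      by (simp add: side_def sgn_zero_iff)
    have "\<forall>\<^sub>F e in at_right (0::real). 0 < e"
      by (simp add: eventually_at_right_less)
    then show ?thesis
      by eventually_elim (simp add: True side_def lev 0 sgn_mult)
  next
    case False
    have lim: "((\<lambda>e. level H (?x e)) \<longlongrightarrow> level H (w F)) (at_right 0)"
      unfolding lev by (auto intro!: tendsto_eq_intros)
    show ?thesis
    proof (cases "level H (w F) > 0")
      case True
      with order_tendstoD(1)[OF lim this] show ?thesis
        using False by (auto simp: side_def elim!: eventually_mono)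
    next
      case neg: False
      then have "level H (w F) < 0"
        using False by (auto simp: side_def sgn_zero_iff)
      with order_tendstoD(2)[OF lim this] show ?thesis
        using False by (auto simp: side_def elim!: eventually_mono)
    qed
  qed
  \<comment> \<open>There are finitely many hyperplanes, so one small e serves them all.\<close>
  then have "\<forall>\<^sub>F e in at_right 0. \<forall>H\<in>\<A>. side H (?x e) = ?s H"
    using arr by (intro eventually_ball_finite) (auto simp: arrangement_def)
  then obtain e where e: "\<forall>H\<in>\<A>. side H (?x e) = ?s H"
    using eventually_happens'[of "at_right (0::real)"] trivial_limit_at_right_real by blast
  show ?thesis
    using e w_cell faces_eq_cells[OF arr] by (intro bexI[of _ "cell \<A> (?x e)"]) auto
qed

text \<open>On hyperplanes through F, the common local chamber E gives D the sign of C. On the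
  others F has a nonzero sign, which D inherits because F lies in its closure. For the converse, E
  is the local cell of \<open>w C\<close>.\<close>

lemma chamber_at_characterization:
  assumes C: "C \<in> chambers \<A>" and F: "F \<in> faces \<A>"
  shows "D \<in> chambers \<A> \<and> F \<subseteq> closure D \<and>
      (\<exists>E \<in> chambers (local_arrangement \<A> F). C \<subseteq> E \<and> D \<subseteq> E) \<longleftrightarrow>
    D \<in> faces \<A> \<and>
      (\<forall>H\<in>\<A>. side H (w D) = (if side H (w F) = 0 then side H (w C) else side H (w F)))"
    (is "?L \<longleftrightarrow> ?R")
proof -
  let ?A = "local_arrangement \<A> F"
  have arrL: "arrangement ?A"
    using arr by (auto simp: arrangement_def local_arrangement_def)
  have hyp: "hyperplane H" if "H \<in> \<A>" for H
    using arr that by (simp add: arrangement_def)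
  show ?thesis
  proof
    assume L: ?L
    then obtain E where E: "E \<in> chambers ?A" "C \<subseteq> E" "D \<subseteq> E"
      by blast
    have D: "D \<in> faces \<A>"
      using L chamber_face by blast
    have "w C \<in> E" "w D \<in> E"
      using E w_in D chamber_face[OF C] by blast+
    then have "side H (w D) = side H (w C)" if "H \<in> ?A" for H
      using E(1) that by (auto simp: chambers_eq_cells[OF arrL] cell_def)
    moreover have "w F \<in> closure D"
      using L w_in F by blast
    then have "side H (w F) = 0 \<or> side H (w F) = side H (w D)" if "H \<in> \<A>" for H
      using that closure_cell[OF arr] face_eq_cell[OF D] by (metis (mono_tags, lifting) mem_Collect_eq)
    ultimately show ?R
      using D by (simp add: local_arrangement_eq[OF F]) metis
  next
    assume R: ?R
    then have D: "D \<in> chambers \<A>"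
      using C by (auto simp: chambers_iff)
    have "(D, F) \<in> face_order \<A>"
      using R F by (auto simp: face_order_iff)
    then have "F \<subseteq> closure D"
      using closure_subset[of F] by (auto simp: face_order_def)
    moreover have "cell ?A (w C) \<in> chambers ?A"
      unfolding chambers_eq_cells[OF arrL] using C hyp side_eq_0_iff
      by (intro imageI) (auto simp: local_arrangement_def chambers_iff)
    moreover have "C \<subseteq> cell ?A (w C)"
      using mem_face_iff[OF chamber_face[OF C]] by (auto simp: cell_def local_arrangement_def)
    moreover have "D \<subseteq> cell ?A (w C)"
      using R mem_face_iff[of D] by (auto simp: cell_def local_arrangement_eq[OF F])
    ultimately show ?L
      using D by blast
  qed
qed

lemma chamber_at_face_side:
  assumes "C \<in> chambers \<A>" "F \<in> faces \<A>"
  shows "chamber_at \<A> C F \<in> faces \<A> \<and>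
    (\<forall>H\<in>\<A>. side H (w (chamber_at \<A> C F)) = (if side H (w F) = 0 then side H (w C) else side H (w F)))"
  unfolding chamber_at_def chamber_at_characterization[OF assms]
proof (rule theI')
  show "\<exists>!D. D \<in> faces \<A> \<and>
      (\<forall>H\<in>\<A>. side H (w D) = (if side H (w F) = 0 then side H (w C) else side H (w F)))"
    using chamber_at_exists[OF assms] faces_eqI by (metis (no_types, lifting))
qed

lemmas side_chamber_at = chamber_at_face_side[THEN conjunct2, rule_format]

lemma chamber_at_chamber:
  assumes "C \<in> chambers \<A>" "F \<in> faces \<A>"
  shows "chamber_at \<A> C F \<in> chambers \<A>"
  using chamber_at_face_side[OF assms] assms(1) by (auto simp: chambers_iff)

lemma chamber_at_le:
  assumes "C \<in> chambers \<A>" "F \<in> faces \<A>"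
  shows "(chamber_at \<A> C F, F) \<in> face_order \<A>"
  using chamber_at_face_side[OF assms] assms by (auto simp: face_order_iff)

lemma chamber_at_id:
  assumes "C \<in> chambers \<A>" "(C, F) \<in> face_order \<A>"
  shows "chamber_at \<A> C F = C"
proof -
  have F: "F \<in> faces \<A>"
    using assms(2) by (simp add: face_order_def)
  show ?thesis
    using chamber_at_face_side[OF assms(1) F] assms by (intro faces_eqI) (auto simp: face_order_iff)
qed

text \<open>This is functoriality of the diagram. A hyperplane through G contains the larger element
  F, so \<open>C\<^sub>F\<close> still has the sign of C there; on all other hyperplanes G alone
  decides.\<close>

lemma chamber_at_chamber_at:
  assumes C: "C \<in> chambers \<A>" and GF: "(G, F) \<in> face_order \<A>"
  shows "chamber_at \<A> (chamber_at \<A> C F) G = chamber_at \<A> C G"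
proof -
  have FG: "F \<in> faces \<A>" "G \<in> faces \<A>"
    using GF by (auto simp: face_order_def)
  note D = chamber_at_chamber[OF C FG(1)]
  show ?thesis
    using chamber_at_face_side[OF D FG(2)] chamber_at_face_side[OF C FG(1)]
      chamber_at_face_side[OF C FG(2)] GF
    by (intro faces_eqI) (auto simp: face_order_iff)
qed

end

section \<open>Quotients, sums and realizations\<close>

text \<open>The class map \<open>p\<close> and \<open>g\<close> are quotient maps with the same
  fibres, so the induced map \<open>h\<close> is an injective quotient map.\<close>

lemma homeomorphic_space_quotient_topology:
  assumes g: "quotient_map T Y g"
  shows "quotient_topology T {(a, b). a \<in> topspace T \<and> b \<in> topspace T \<and> g a = g b} homeomorphic_space Y"
    (is "quotient_topology T ?R homeomorphic_space Y")
proof -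
  let ?Q = "quotient_topology T ?R"
  define p where "p a = ?R `` {a}" for a
  have equiv: "equiv (topspace T) ?R"
    by (rule equivI) (auto simp: refl_on_def sym_def trans_def)
  note op = openin_quotient_topology[OF equiv]
  have p_eq: "p x = p y \<longleftrightarrow> g x = g y" if "x \<in> topspace T" "y \<in> topspace T" for x y
    using eq_equiv_class_iff[OF equiv that] that by (simp add: p_def)
  have quot: "topspace T // ?R = p ` topspace T"
    by (auto simp: quotient_def p_def)
  have top: "topspace ?Q = p ` topspace T"
  proof
    show "topspace ?Q \<subseteq> p ` topspace T"
      using op openin_topspace unfolding quot by blast
    have "openin ?Q (topspace T // ?R)"
      by (simp add: op Union_quotient[OF equiv])
    then show "p ` topspace T \<subseteq> topspace ?Q"
      unfolding quot by (rule openin_subset)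
  qed
  \<comment> \<open>A set of classes pulls back under \<open>p\<close> to its union, so the openness
    built into \<open>quotient_topology\<close> is exactly what a quotient map requires.\<close>
  have pre: "{x \<in> topspace T. p x \<in> U} = \<Union>U" if U: "U \<subseteq> p ` topspace T" for U
  proof
    show "{x \<in> topspace T. p x \<in> U} \<subseteq> \<Union>U"
      by (auto simp: p_def)
    have "x \<in> topspace T \<and> p x = X" if X: "X \<in> U" "x \<in> X" for X x
    proof -
      obtain a where "a \<in> topspace T" "X = p a"
        using U X(1) by blast
      moreover from this have "x \<in> topspace T" "g a = g x"
        using X(2) by (auto simp: p_def)
      ultimately show ?thesis
        by (simp add: p_eq)
    qed
    then show "\<Union>U \<subseteq> {x \<in> topspace T. p x \<in> U}"
      by blast
  qed
  have p: "quotient_map T ?Q p"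
    unfolding quotient_map_def top using pre by (simp add: op quot)
  have "\<exists>h. \<forall>x\<in>topspace T. h (p x) = g x"
  proof (rule quotient_map_lift_exists[OF p quotient_imp_continuous_map[OF g]])
    show "g x = g y" if "x \<in> topspace T" "y \<in> topspace T" "p x = p y" for x y
      using that p_eq by blast
  qed blast
  then obtain h where h: "\<And>x. x \<in> topspace T \<Longrightarrow> h (p x) = g x"
    by blast
  have "quotient_map T Y (h \<circ> p)"
    by (rule quotient_map_eq[OF g]) (simp add: h)
  then have "quotient_map ?Q Y h"
    using quotient_map_compose_eq[OF p] by blast
  moreover have "inj_on h (topspace ?Q)"
    unfolding top by (auto simp: inj_on_def h p_eq)
  ultimately show ?thesis
    unfolding homeomorphic_space by (auto simp: homeomorphic_map_def)
qed

section \<open>Compactness of, and continuity on, sums, products and realizations\<close>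

lemma compact_space_sum_topology:
  assumes "finite I" "\<And>i. i \<in> I \<Longrightarrow> compact_space (X i)"
  shows "compact_space (sum_topology X I)"
proof -
  have "compactin (sum_topology X I) (\<Union>i\<in>I. Pair i ` topspace (X i))"
    using assms
    by (intro compactin_Union)
      (auto simp: compact_space_def intro!: image_compactin continuous_map_component_injection)
  moreover have "(\<Union>i\<in>I. Pair i ` topspace (X i)) = topspace (sum_topology X I)"
    by auto
  ultimately show ?thesis
    by (simp add: compact_space_def)
qed

lemma continuous_map_from_sum_topology:
  assumes "\<And>i. i \<in> I \<Longrightarrow> continuous_map (X i) Y (\<lambda>x. f (i, x))"
  shows "continuous_map (sum_topology X I) Y f"
  unfolding continuous_map
proof (intro conjI allI impI)
  show "f ` topspace (sum_topology X I) \<subseteq> topspace Y"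
    using assms by (fastforce simp: continuous_map)
  show "openin (sum_topology X I) {x \<in> topspace (sum_topology X I). f x \<in> U}" if "openin Y U" for U
    unfolding openin_sum_topology
  proof (intro conjI ballI)
    fix i
    assume i: "i \<in> I"
    then have "openin (X i) {x \<in> topspace (X i). f (i, x) \<in> U}"
      using assms that by (auto simp: continuous_map)
    then show "openin (X i) {x. (i, x) \<in> {x \<in> topspace (sum_topology X I). f x \<in> U}}"
      using i by simp
  qed auto
qed

text \<open>Every slice over a point of the discrete factor is open, so continuity can be checked
  slice by slice.\<close>

lemma continuous_map_from_discrete_prod:
  assumes "\<And>x. x \<in> S \<Longrightarrow> continuous_map X Y (\<lambda>t. f (x, t))"
  shows "continuous_map (prod_topology (discrete_topology S) X) Y f"
  unfolding continuous_map
proof (intro conjI allI impI)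
  show "f ` topspace (prod_topology (discrete_topology S) X) \<subseteq> topspace Y"
    using assms by (fastforce simp: continuous_map)
  fix U
  assume "openin Y U"
  then have "openin X {t \<in> topspace X. f (x, t) \<in> U}" if "x \<in> S" for x
    using assms that by (auto simp: continuous_map)
  then have "openin (prod_topology (discrete_topology S) X)
      (\<Union>x\<in>S. {x} \<times> {t \<in> topspace X. f (x, t) \<in> U})"
    by (intro openin_Union) (auto simp: openin_prod_Times_iff)
  moreover have "(\<Union>x\<in>S. {x} \<times> {t \<in> topspace X. f (x, t) \<in> U}) =
      {z \<in> topspace (prod_topology (discrete_topology S) X). f z \<in> U}"
    by auto
  ultimately show "openin (prod_topology (discrete_topology S) X)
      {z \<in> topspace (prod_topology (discrete_topology S) X). f z \<in> U}"
    by simp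
qed

text \<open>Coordinates outside \<sigma> are confined to 0, so this is a closed part of a product of
  compact sets, however large the vertex type is.\<close>

lemma compact_simplex_coordinates:
  assumes "finite \<sigma>"
  shows "compact {t :: 'v \<Rightarrow> real. (\<forall>v. 0 \<le> t v) \<and> {v. t v \<noteq> 0} \<subseteq> \<sigma> \<and> sum t \<sigma> = 1}"
proof -
  have "compactin (product_topology (\<lambda>_. euclidean) UNIV) (PiE UNIV (\<lambda>v::'v. if v \<in> \<sigma> then {0..1::real} else {0}))"
    by (auto simp: compactin_PiE)
  then have "compact (PiE UNIV (\<lambda>v::'v. if v \<in> \<sigma> then {0..1::real} else {0}))"
    by (simp add: euclidean_product_topology)
  moreover have "closed {t :: 'v \<Rightarrow> real. sum t \<sigma> = 1}"
    by (intro closed_Collect_eq continuous_intros continuous_on_product_coordinates)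
  ultimately have "compact (PiE UNIV (\<lambda>v::'v. if v \<in> \<sigma> then {0..1::real} else {0}) \<inter> {t. sum t \<sigma> = 1})"
    by (rule compact_Int_closed)
  moreover have "PiE UNIV (\<lambda>v::'v. if v \<in> \<sigma> then {0..1::real} else {0}) \<inter> {t. sum t \<sigma> = 1} =
    {t. (\<forall>v. 0 \<le> t v) \<and> {v. t v \<noteq> 0} \<subseteq> \<sigma> \<and> sum t \<sigma> = 1}" (is "?A = ?B")
  proof
    show "?A \<subseteq> ?B"
    proof
      fix t assume t: "t \<in> ?A"
      then have *: "t v \<in> (if v \<in> \<sigma> then {0..1} else {0})" for v
        by blast
      have "0 \<le> t v" "t v \<noteq> 0 \<Longrightarrow> v \<in> \<sigma>" for v
        using *[of v] by (auto split: if_splits)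
      then show "t \<in> ?B"
        using t by auto
    qed
    show "?B \<subseteq> ?A"
    proof
      fix t assume t: "t \<in> ?B"
      have "t v \<le> 1" if "v \<in> \<sigma>" for v
        using member_le_sum[of v \<sigma> t] that assms t by auto
      then show "t \<in> ?A"
        using t by auto
    qed
  qed
  ultimately show ?thesis
    by simp
qed

text \<open>Points with support exactly \<sigma> form an open simplex, in general not compact.
  Closure of K under nonempty subsets allows closed simplices, with support inside \<sigma>, and
  finitely many of them cover the realization.\<close>

lemma compact_space_realization:
  assumes "finite K" "\<And>\<sigma>. \<sigma> \<in> K \<Longrightarrow> finite \<sigma>"
    and down: "\<And>\<sigma> \<tau>. \<sigma> \<in> K \<Longrightarrow> \<tau> \<subseteq> \<sigma> \<Longrightarrow> \<tau> \<noteq> {} \<Longrightarrow> \<tau> \<in> K"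
  shows "compact_space (realization K)"
proof -
  have "{t. (\<forall>v. 0 \<le> t v) \<and> {v. t v \<noteq> 0} \<in> K \<and> (\<Sum>v | t v \<noteq> 0. t v) = 1} =
    (\<Union>\<sigma>\<in>K. {t :: 'a \<Rightarrow> real. (\<forall>v. 0 \<le> t v) \<and> {v. t v \<noteq> 0} \<subseteq> \<sigma> \<and> sum t \<sigma> = 1})" (is "?A = ?B")
  proof
    show "?A \<subseteq> ?B"
      by auto
    show "?B \<subseteq> ?A"
    proof
      fix t assume "t \<in> ?B"
      then obtain \<sigma> where \<sigma>: "\<sigma> \<in> K" "\<And>v. 0 \<le> t v" "{v. t v \<noteq> 0} \<subseteq> \<sigma>" "sum t \<sigma> = 1"
        by auto
      then have "(\<Sum>v | t v \<noteq> 0. t v) = 1"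
        using sum.mono_neutral_left[OF assms(2)[OF \<sigma>(1)] \<sigma>(3), of t] by auto
      moreover from this have "{v. t v \<noteq> 0} \<noteq> {}"
        by force
      ultimately show "t \<in> ?A"
        using \<sigma> down by auto
    qed
  qed
  moreover have "compact ?B"
    using assms(1,2) by (intro compact_UN compact_simplex_coordinates)
  ultimately show ?thesis
    by (simp add: realization_def compact_space_subtopology)
qed

lemma simplicially_isomorphic_image:
  assumes "inj_on f (\<Union>K)"
  shows "simplicially_isomorphic K ((`) f ` K)"
  unfolding simplicially_isomorphic_def
proof (intro exI conjI allI impI)
  show "bij_betw f (\<Union>K) (\<Union>((`) f ` K))"
    using assms by (simp add: bij_betw_def image_Union)
  fix \<sigma>
  assume \<sigma>: "\<sigma> \<subseteq> \<Union>K"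
  have "\<sigma> = \<tau>" if "\<tau> \<in> K" "f ` \<sigma> = f ` \<tau>" for \<tau>
    using inj_on_image_eq_iff[OF assms \<sigma>, of \<tau>] that by blast
  then show "\<sigma> \<in> K \<longleftrightarrow> f ` \<sigma> \<in> (`) f ` K"
    by blast
qed

section \<open>Finite chains\<close>

lemma finite_chain_least:
  assumes "finite S" "S \<noteq> {}" "S \<in> Chains r" "trans r"
  shows "\<exists>m\<in>S. \<forall>q\<in>S. (m, q) \<in> r"
  using assms(1-3)
proof (induction rule: finite_ne_induct)
  case (singleton x)
  then show ?case
    by (auto simp: Chains_def)
next
  case (insert x S)
  then obtain m where m: "m \<in> S" "\<forall>q\<in>S. (m, q) \<in> r"
    by (auto simp: Chains_def)
  have xx: "(x, x) \<in> r" and xm: "(x, m) \<in> r \<or> (m, x) \<in> r"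
    using insert.prems m(1) by (auto simp: Chains_def)
  from xm show ?case
  proof
    assume "(x, m) \<in> r"
    then have "\<forall>q\<in>insert x S. (x, q) \<in> r"
      using m xx transD[OF assms(4)] by blast
    then show ?thesis
      by blast
  qed (use m in blast)
qed

lemma finite_chain_greatest:
  assumes "finite S" "S \<noteq> {}" "S \<in> Chains r" "trans r"
  shows "\<exists>m\<in>S. \<forall>q\<in>S. (q, m) \<in> r"
  using finite_chain_least[of S "r\<inverse>"] assms by (auto simp: Chains_def)

text \<open>The least element is removed and appended at the end, because simplices of
  \<open>Sal\<close> list their faces in descending order. Strictness comes from the
  removal.\<close>

lemma finite_chain_enum:
  assumes "finite S" "S \<noteq> {}" "S \<in> Chains r" "trans r"
  shows "\<exists>f (k::nat). S = f ` {..k} \<and> (\<forall>i<k. (f (Suc i), f i) \<in> r \<and> f (Suc i) \<noteq> f i)"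
  using assms(1-3)
proof (induction S rule: finite_psubset_induct)
  case (psubset S)
  obtain m where m: "m \<in> S" "\<forall>q\<in>S. (m, q) \<in> r"
    using finite_chain_least[OF psubset.hyps psubset.prems assms(4)] by blast
  show ?case
  proof (cases "S = {m}")
    case True
    then show ?thesis
      by (intro exI[of _ "\<lambda>_. m"] exI[of _ 0]) auto
  next
    case False
    have "S - {m} \<subset> S" and "S - {m} \<noteq> {}" and "S - {m} \<in> Chains r"
      using m(1) False psubset.prems by (auto simp: Chains_def)
    then obtain f and k :: nat where f: "S - {m} = f ` {..k}"
      "\<forall>i<k. (f (Suc i), f i) \<in> r \<and> f (Suc i) \<noteq> f i"
      using psubset.IH[of "S - {m}"] by metis
    have "f k \<in> S - {m}"
      using f(1) by auto
    then have mf: "(m, f k) \<in> r" "f k \<noteq> m"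
      using m(2) by auto
    define g where "g = f(Suc k := m)"
    have "g ` {..k} = f ` {..k}" and "g (Suc k) = m"
      by (auto simp: g_def)
    then have "g ` {..Suc k} = insert m (S - {m})"
      by (simp only: atMost_Suc image_insert f(1))
    then have S: "S = g ` {..Suc k}"
      using insert_Diff[OF m(1)] by simp
    have "\<forall>i<Suc k. (g (Suc i), g i) \<in> r \<and> g (Suc i) \<noteq> g i"
      using f(2) mf by (auto simp: less_Suc_eq g_def)
    then show ?thesis
      using S by blast
  qed
qed

lemma descending_image_Chains:
  assumes "trans r" "\<And>i. i \<le> k \<Longrightarrow> (f i, f i) \<in> r" "\<And>i::nat. i < k \<Longrightarrow> (f (Suc i), f i) \<in> r"
  shows "f ` {..k} \<in> Chains r"
proof -
  have "(f j, f i) \<in> r" if "i \<le> j" "j \<le> k" for i j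
    using that
  proof (induction j rule: dec_induct)
    case base
    then show ?case
      by (rule assms(2))
  next
    case (step j)
    then show ?case
      using assms(3)[of j] by (auto intro: transD[OF assms(1)])
  qed
  then have "(f j, f i) \<in> r \<or> (f i, f j) \<in> r" if "i \<le> k" "j \<le> k" for i j
    using that linear[of i j] by blast
  then show ?thesis
    unfolding Chains_def by blast
qed

section \<open>Chains in the poset limit\<close>

context pointed_arrangement
begin

text \<open>Summing over all faces gives one index set for all weight functions; the weights
  considered vanish off a chain of faces.\<close>

abbreviation face_sum :: "('a set \<Rightarrow> real) \<Rightarrow> ('a set \<Rightarrow> 'b::real_vector) \<Rightarrow> 'b" where
  "face_sum t f \<equiv> \<Sum>q\<in>faces \<A>. t q *\<^sub>R f q"

text \<open>The second component is meant to be \<open>C\<^sub>F\<close> itself, so the argument is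
  an element of the poset limit; \<open>salvetti_vertex\<close> takes any chamber and transports it
  first.\<close>

definition vertex :: "'a set \<times> 'a set \<Rightarrow> 'a \<times> 'a" where
  "vertex p = (w (fst p), w (fst p) - w (snd p))"

definition salvetti_map :: "'a set \<times> 'a set \<times> ('a set \<Rightarrow> real) \<Rightarrow> 'a \<times> 'a" where
  "salvetti_map = (\<lambda>(p, C, t). face_sum t (\<lambda>q. vertex (q, chamber_at \<A> C q)))"

lemma trans_face_order: "trans (face_order \<A>)"
  using face_order_trans by (blast intro: transI)

lemma face_orderD: "(G, F) \<in> face_order \<A> \<Longrightarrow> G \<in> faces \<A> \<and> F \<in> faces \<A>"
  by (simp add: face_order_def)

lemma Field_face_order: "Field (face_order \<A>) = faces \<A>"
  using face_order_refl face_orderD by (fastforce simp: Field_def)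

lemma Chains_faces:
  assumes "S \<in> Chains (face_order \<A>)"
  shows "S \<subseteq> faces \<A>"
  using assms face_orderD by (auto simp: Chains_def)

lemma finite_Chains: "S \<in> Chains (face_order \<A>) \<Longrightarrow> finite S"
  using Chains_faces finite_faces finite_subset by blast

lemma support_nonempty:
  assumes "sum t (faces \<A>) \<noteq> (0 :: real)"
  shows "{q. t q \<noteq> 0} \<noteq> {}"
proof
  assume "{q. t q \<noteq> 0} = {}"
  then have "t q = 0" for q
    by blast
  then show False
    using assms by simp
qed

lemma support_least:
  assumes "{q. t q \<noteq> (0 :: real)} \<in> Chains (face_order \<A>)" "{q. t q \<noteq> 0} \<noteq> {}"
  obtains m where "t m \<noteq> 0" "\<And>q. t q \<noteq> 0 \<Longrightarrow> (m, q) \<in> face_order \<A>"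
  using finite_chain_least[OF finite_Chains[OF assms(1)] assms(2,1) trans_face_order] that by auto

lemma support_greatest:
  assumes "{q. t q \<noteq> (0 :: real)} \<in> Chains (face_order \<A>)" "{q. t q \<noteq> 0} \<noteq> {}"
  obtains m where "t m \<noteq> 0" "\<And>q. t q \<noteq> 0 \<Longrightarrow> (q, m) \<in> face_order \<A>"
  using finite_chain_greatest[OF finite_Chains[OF assms(1)] assms(2,1) trans_face_order] that by auto

lemma order_complex_under_iff:
  "S \<in> order_complex (Restr (face_order \<A>) (under (face_order \<A>) p)) \<longleftrightarrow>
     S \<in> Chains (face_order \<A>) \<and> S \<noteq> {} \<and> (\<forall>q\<in>S. (q, p) \<in> face_order \<A>)" (is "?L \<longleftrightarrow> ?R")
proof
  assume ?L
  then show ?R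
    by (auto simp: order_complex_def Chains_def under_def)
next
  assume ?R
  then show ?L
    using finite_Chains by (auto simp: order_complex_def Chains_def under_def)
qed

lemma mem_realization_iff:
  "t \<in> topspace (realization (order_complex (Restr (face_order \<A>) (under (face_order \<A>) p)))) \<longleftrightarrow>
     (\<forall>q. 0 \<le> t q) \<and> {q. t q \<noteq> 0} \<in> Chains (face_order \<A>) \<and>
     (\<forall>q. t q \<noteq> 0 \<longrightarrow> (q, p) \<in> face_order \<A>) \<and> sum t (faces \<A>) = 1" (is "?L \<longleftrightarrow> ?R")
proof -
  have "(\<Sum>q | t q \<noteq> 0. t q) = sum t (faces \<A>)" if "{q. t q \<noteq> 0} \<in> Chains (face_order \<A>)"
    using Chains_faces[OF that] finite_faces by (intro sum.mono_neutral_left) auto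
  moreover have "{q. t q \<noteq> 0} \<noteq> {}" if "sum t (faces \<A>) = 1"
    using support_nonempty[of t] that by simp
  ultimately show ?thesis
    unfolding realization_def by (simp add: order_complex_under_iff) metis
qed

lemma mem_hocolim_sum_iff:
  "(p, C, t) \<in> topspace (hocolim_sum (face_order \<A>) (D_id_space \<A>)) \<longleftrightarrow>
     C \<in> chambers \<A> \<and> (C, p) \<in> face_order \<A> \<and>
     (\<forall>q. 0 \<le> t q) \<and> {q. t q \<noteq> 0} \<in> Chains (face_order \<A>) \<and>
     (\<forall>q. t q \<noteq> 0 \<longrightarrow> (q, p) \<in> face_order \<A>) \<and> sum t (faces \<A>) = 1"
  using face_orderD by (auto simp: hocolim_sum_def Field_face_order D_id_space_def mem_realization_iff)

lemma hocolim_glue_iff: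
  "hocolim_glue (face_order \<A>) (D_id_space \<A>) (D_id_map \<A>) a b \<longleftrightarrow>
    (\<exists>p q C t. q \<noteq> p \<and> (q, p) \<in> face_order \<A> \<and> C \<in> chambers \<A> \<and> (C, p) \<in> face_order \<A> \<and>
      (\<forall>q. 0 \<le> t q) \<and> {q. t q \<noteq> 0} \<in> Chains (face_order \<A>) \<and>
      (\<forall>r. t r \<noteq> 0 \<longrightarrow> (r, q) \<in> face_order \<A>) \<and> sum t (faces \<A>) = 1 \<and>
      a = (p, C, t) \<and> b = (q, chamber_at \<A> C q, t))"
  unfolding hocolim_glue_def mem_realization_iff
  by (auto simp: D_id_space_def D_id_map_def)

lemma mem_Plim_iff:
  "((q, D), (p, C)) \<in> Plim (face_order \<A>) (D_id_space \<A>) (D_id_map \<A>) \<longleftrightarrow>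
     (q, p) \<in> face_order \<A> \<and> C \<in> chambers \<A> \<and> (C, p) \<in> face_order \<A> \<and> D = chamber_at \<A> C q"
  using chamber_at_le chamber_at_chamber face_orderD
  by (auto simp: Plim_def D_id_space_def D_id_map_def)

text \<open>The chamber \<open>C\<close> can be taken over the greatest face of the chain.\<close>

lemma order_complex_Plim:
  "order_complex (Plim (face_order \<A>) (D_id_space \<A>) (D_id_map \<A>)) =
     {(\<lambda>q. (q, chamber_at \<A> C q)) ` S | C S. C \<in> chambers \<A> \<and> S \<in> Chains (face_order \<A>) \<and> S \<noteq> {}}"
  (is "order_complex ?P = ?K")
proof
  show "?K \<subseteq> order_complex ?P"
  proof
    fix \<sigma> assume "\<sigma> \<in> ?K"
    then obtain C S where \<sigma>: "\<sigma> = (\<lambda>q. (q, chamber_at \<A> C q)) ` S"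
      "C \<in> chambers \<A>" "S \<in> Chains (face_order \<A>)" "S \<noteq> {}"
      by blast
    have "((q, chamber_at \<A> C q), (p, chamber_at \<A> C p)) \<in> ?P" if "(q, p) \<in> face_order \<A>" for p q
      using that \<sigma>(2) face_orderD[OF that]
      by (simp add: mem_Plim_iff chamber_at_chamber_at chamber_at_chamber chamber_at_le)
    then have "\<sigma> \<in> Chains ?P"
      using \<sigma>(3) unfolding \<sigma>(1) Chains_def by blast
    then show "\<sigma> \<in> order_complex ?P"
      using \<sigma> finite_Chains by (auto simp: order_complex_def)
  qed
  have "trans ?P"
  proof (rule transI)
    fix x y z assume "(x, y) \<in> ?P" "(y, z) \<in> ?P"
    then show "(x, z) \<in> ?P"
      by (cases x, cases y, cases z) (auto simp: mem_Plim_iff chamber_at_chamber_at intro: face_order_trans)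
  qed
  show "order_complex ?P \<subseteq> ?K"
  proof
    fix \<sigma> assume "\<sigma> \<in> order_complex ?P"
    then have \<sigma>: "\<sigma> \<in> Chains ?P" "finite \<sigma>" "\<sigma> \<noteq> {}"
      by (auto simp: order_complex_def)
    then obtain p C where max: "(p, C) \<in> \<sigma>" "\<forall>x\<in>\<sigma>. (x, (p, C)) \<in> ?P"
      using finite_chain_greatest[OF \<sigma>(2,3,1) \<open>trans ?P\<close>] by (metis surj_pair)
    have "x = (fst x, chamber_at \<A> C (fst x))" if "x \<in> \<sigma>" for x
      using max(2) that by (cases x) (auto simp: mem_Plim_iff)
    then have "\<sigma> = (\<lambda>q. (q, chamber_at \<A> C q)) ` fst ` \<sigma>"
      by (simp add: image_image)
    moreover have "C \<in> chambers \<A>"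
      using max by (auto simp: mem_Plim_iff)
    moreover have "(fst x, fst y) \<in> face_order \<A>" if "(x, y) \<in> ?P" for x y
      using that by (cases x, cases y) (simp add: mem_Plim_iff)
    then have "fst ` \<sigma> \<in> Chains (face_order \<A>)"
      using \<sigma>(1) unfolding Chains_def by blast
    ultimately show "\<sigma> \<in> ?K"
      using \<sigma>(3) by blast
  qed
qed

text \<open>The real part determines the face, and then the imaginary part determines the point of
  the chamber.\<close>

lemma inj_vertex: "inj_on vertex (faces \<A> \<times> faces \<A>)"
  using w_inj by (auto simp: inj_on_def vertex_def)

text \<open>The compatibility condition allows every \<open>C i\<close> to be replaced by
  \<open>C 0\<close>, so a simplex is a chain of faces with one chamber transported along it.
  Conversely, a constant family of chambers is compatible.\<close>

lemma Sal_eq: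
  "Sal \<A> w = (`) vertex ` order_complex (Plim (face_order \<A>) (D_id_space \<A>) (D_id_map \<A>))"
proof -
  have vert: "salvetti_vertex \<A> w F C = vertex (F, chamber_at \<A> C F)" for F C
    by (simp add: salvetti_vertex_def vertex_def)
  show ?thesis
  proof
    show "Sal \<A> w \<subseteq> (`) vertex ` order_complex (Plim (face_order \<A>) (D_id_space \<A>) (D_id_map \<A>))"
    proof
      fix \<sigma> assume "\<sigma> \<in> Sal \<A> w"
      then obtain F C and k :: nat where \<sigma>: "\<sigma> = (\<lambda>i. salvetti_vertex \<A> w (F i) (C i)) ` {..k}"
        "\<forall>i\<le>k. F i \<in> faces \<A> \<and> C i \<in> chambers \<A>"
        "\<forall>i<k. (F (Suc i), F i) \<in> face_order \<A> \<and> F (Suc i) \<noteq> F i"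
        "\<forall>i\<le>k. chamber_at \<A> (C 0) (F i) = chamber_at \<A> (C i) (F i)"
        unfolding Sal_def by blast
      have "F ` {..k} \<in> Chains (face_order \<A>)"
        using \<sigma>(2,3) by (intro descending_image_Chains trans_face_order) (auto intro: face_order_refl)
      moreover have "\<sigma> = vertex ` (\<lambda>q. (q, chamber_at \<A> (C 0) q)) ` F ` {..k}"
        unfolding \<sigma>(1) image_image using \<sigma>(4) by (intro image_cong) (auto simp: vert)
      moreover have "C 0 \<in> chambers \<A>" "F ` {..k} \<noteq> {}"
        using \<sigma>(2) by auto
      ultimately show "\<sigma> \<in> (`) vertex ` order_complex (Plim (face_order \<A>) (D_id_space \<A>) (D_id_map \<A>))"
        unfolding order_complex_Plim by blast
    qed
    show "(`) vertex ` order_complex (Plim (face_order \<A>) (D_id_space \<A>) (D_id_map \<A>)) \<subseteq> Sal \<A> w"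
    proof
      fix \<sigma> assume "\<sigma> \<in> (`) vertex ` order_complex (Plim (face_order \<A>) (D_id_space \<A>) (D_id_map \<A>))"
      then obtain C S where S: "\<sigma> = vertex ` (\<lambda>q. (q, chamber_at \<A> C q)) ` S"
        "C \<in> chambers \<A>" "S \<in> Chains (face_order \<A>)" "S \<noteq> {}"
        unfolding order_complex_Plim by blast
      obtain F and k :: nat where F: "S = F ` {..k}"
        "\<forall>i<k. (F (Suc i), F i) \<in> face_order \<A> \<and> F (Suc i) \<noteq> F i"
        using finite_chain_enum[OF finite_Chains[OF S(3)] S(4,3) trans_face_order] by blast
      have "\<sigma> = (\<lambda>i. salvetti_vertex \<A> w (F i) C) ` {..k}"
        unfolding S(1) F(1) image_image vert ..
      moreover have "\<forall>i\<le>k. F i \<in> faces \<A>"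
        using Chains_faces[OF S(3)] F(1) by auto
      ultimately show "\<sigma> \<in> Sal \<A> w"
        unfolding Sal_def using S(2) F(2)
        by (intro CollectI exI[of _ F] exI[of _ "\<lambda>_. C"] exI[of _ k]) auto
    qed
  qed
qed

lemma Plim_simplicially_isomorphic_Sal:
  "simplicially_isomorphic (order_complex (Plim (face_order \<A>) (D_id_space \<A>) (D_id_map \<A>))) (Sal \<A> w)"
  unfolding Sal_eq
proof (rule simplicially_isomorphic_image, rule inj_on_subset[OF inj_vertex])
  show "\<Union>(order_complex (Plim (face_order \<A>) (D_id_space \<A>) (D_id_map \<A>))) \<subseteq> faces \<A> \<times> faces \<A>"
    using Chains_faces chamber_at_face_side unfolding order_complex_Plim by blast
qed

section \<open>The map onto the Salvetti complex\<close>

lemma face_sum_level: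
  "(\<Sum>q\<in>faces \<A>. t q * level H (f q)) = normal H \<bullet> face_sum t f - sum t (faces \<A>) * offset H"
  by (rule level_sum)

text \<open>The points \<open>f q\<close> are arbitrary because this serves twice: for the points
  \<open>w q\<close>, and for the points of the chambers over the faces q.\<close>

lemma sgn_face_sum:
  assumes "\<And>q. 0 \<le> t q" "m \<in> faces \<A>" "t m \<noteq> 0"
    and "\<And>q. t q \<noteq> 0 \<Longrightarrow> side H (f q) = 0 \<or> side H (f q) = side H (f m)"
  shows "sgn (\<Sum>q\<in>faces \<A>. t q * level H (f q)) = side H (f m)"
  using assms finite_faces
  by (intro sgn_weighted_sum[of _ _ _ _ m]) (auto simp: side_def order.strict_iff_order)

text \<open>The point \<open>face_sum t w\<close> lies in the smallest face of the support, so subtracting the common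
  part of the two weights would leave disjoint supports with the same smallest face.\<close>

lemma face_sum_weights_unique:
  assumes t: "\<And>q. 0 \<le> t q" "{q. t q \<noteq> 0} \<in> Chains (face_order \<A>)"
    and t': "\<And>q. 0 \<le> t' q" "{q. t' q \<noteq> 0} \<in> Chains (face_order \<A>)"
    and eq: "sum t (faces \<A>) = sum t' (faces \<A>)" "face_sum t w = face_sum t' w"
  shows "t = t'"
proof (rule ccontr)
  define u where "u q = t q - min (t q) (t' q)" for q
  define u' where "u' q = t' q - min (t q) (t' q)" for q
  note u_defs = u_def u'_def
  have nonneg: "0 \<le> u q" "0 \<le> u' q" and disj: "u q = 0 \<or> u' q = 0" for q
    by (auto simp: u_defs min_def)
  have sup: "{q. u q \<noteq> 0} \<subseteq> {q. t q \<noteq> 0}" "{q. u' q \<noteq> 0} \<subseteq> {q. t' q \<noteq> 0}"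
    using t(1) t'(1) by (auto simp: u_defs min_def split: if_splits) (metis order_antisym)+
  have chains: "{q. u q \<noteq> 0} \<in> Chains (face_order \<A>)" "{q. u' q \<noteq> 0} \<in> Chains (face_order \<A>)"
    using sup t(2) t'(2) unfolding Chains_def by blast+
  have sum_eq: "sum u (faces \<A>) = sum u' (faces \<A>)"
    by (simp add: u_defs sum_subtractf eq)
  have fs_eq: "face_sum u w = face_sum u' w"
    by (simp add: u_defs scaleR_left_diff_distrib sum_subtractf eq)
  assume "t \<noteq> t'"
  then obtain r where "t r \<noteq> t' r"
    by blast
  then have "u r \<noteq> 0 \<or> u' r \<noteq> 0"
    by (auto simp: u_defs min_def)
  moreover have "r \<in> faces \<A>" if "u r \<noteq> 0 \<or> u' r \<noteq> 0"
    using that chains Chains_faces by blast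
  \<comment> \<open>Nonnegative weights with total 0 all vanish. As u and u' have equal totals, one
    nonzero weight makes both supports nonempty.\<close>
  moreover have "sum v (faces \<A>) \<noteq> 0" if "\<And>q. 0 \<le> v q" "r \<in> faces \<A>" "v r \<noteq> 0" for v :: "'a set \<Rightarrow> real"
    using that finite_faces by (auto simp: sum_nonneg_eq_0_iff)
  ultimately have "sum u (faces \<A>) \<noteq> 0"
    using nonneg sum_eq by auto
  then have "{q. u q \<noteq> 0} \<noteq> {}" "{q. u' q \<noteq> 0} \<noteq> {}"
    using sum_eq support_nonempty[of u] support_nonempty[of u'] by simp_all
  note supports = this
  obtain m where m: "u m \<noteq> 0" "\<And>q. u q \<noteq> 0 \<Longrightarrow> (m, q) \<in> face_order \<A>"
    using support_least[OF chains(1) supports(1)] by metis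
  obtain m' where m': "u' m' \<noteq> 0" "\<And>q. u' q \<noteq> 0 \<Longrightarrow> (m', q) \<in> face_order \<A>"
    using support_least[OF chains(2) supports(2)] by metis
  have faces: "m \<in> faces \<A>" "m' \<in> faces \<A>"
    using m m' face_orderD by blast+
  \<comment> \<open>The totals of u and u' need not be 1, so the weighted sum itself need not lie in
    a face. Total and weighted sum together still determine the weighted level, whose sign is that
    of the smallest face.\<close>
  have "side H (w m) = side H (w m')" if "H \<in> \<A>" for H
  proof -
    have "sgn (\<Sum>q\<in>faces \<A>. u q * level H (w q)) = side H (w m)"
      using m(2) that by (intro sgn_face_sum nonneg faces m(1)) (auto simp: face_order_iff)
    moreover have "sgn (\<Sum>q\<in>faces \<A>. u' q * level H (w q)) = side H (w m')"
      using m'(2) that by (intro sgn_face_sum nonneg faces m'(1)) (auto simp: face_order_iff)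
    ultimately show ?thesis
      by (simp add: face_sum_level sum_eq fs_eq)
  qed
  then have "m = m'"
    by (rule faces_eqI[OF faces])
  then show False
    using m(1) m'(1) disj by blast
qed

text \<open>Restricted to the faces where the chambers differ, the weighted sum lies in the local chamber of
  the smallest of these faces.\<close>

lemma face_sum_chambers_unique:
  assumes t: "\<And>q. 0 \<le> t q" "{q. t q \<noteq> 0} \<in> Chains (face_order \<A>)"
    and C: "C \<in> chambers \<A>" "C' \<in> chambers \<A>"
    and eq: "face_sum t (\<lambda>q. w (chamber_at \<A> C q)) = face_sum t (\<lambda>q. w (chamber_at \<A> C' q))"
    and r: "t r \<noteq> 0"
  shows "chamber_at \<A> C r = chamber_at \<A> C' r"
proof (rule ccontr)
  assume "chamber_at \<A> C r \<noteq> chamber_at \<A> C' r"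
  define u where "u q = (if chamber_at \<A> C q = chamber_at \<A> C' q then 0 else t q)" for q
  have nonneg: "0 \<le> u q" for q
    by (simp add: u_def t(1))
  have "{q. u q \<noteq> 0} \<in> Chains (face_order \<A>)"
    using t(2) unfolding Chains_def u_def by auto
  moreover have "{q. u q \<noteq> 0} \<noteq> {}"
    using r \<open>chamber_at \<A> C r \<noteq> chamber_at \<A> C' r\<close> by (auto simp: u_def)
  ultimately obtain m where m: "u m \<noteq> 0" "\<And>q. u q \<noteq> 0 \<Longrightarrow> (m, q) \<in> face_order \<A>"
    using support_least[of u] by metis
  then have mf: "m \<in> faces \<A>"
    using face_orderD by blast
  \<comment> \<open>Terms where the chambers agree cancel in the difference, which permits passing
    from t to u.\<close>
  have "face_sum t (\<lambda>q. w (chamber_at \<A> C q) - w (chamber_at \<A> C' q)) =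
      face_sum u (\<lambda>q. w (chamber_at \<A> C q) - w (chamber_at \<A> C' q))"
    by (intro sum.cong) (auto simp: u_def)
  then have fs_eq: "face_sum u (\<lambda>q. w (chamber_at \<A> C q)) = face_sum u (\<lambda>q. w (chamber_at \<A> C' q))"
    using eq by (simp add: scaleR_right_diff_distrib sum_subtractf)
  have "side H (w (chamber_at \<A> C m)) = side H (w (chamber_at \<A> C' m))" if H: "H \<in> \<A>" for H
  proof (cases "side H (w m) = 0")
    case True
    \<comment> \<open>All faces in the support of u lie above m, hence in H, so every chamber over
      them has the sign of B at H.\<close>
    have *: "sgn (\<Sum>q\<in>faces \<A>. u q * level H (w (chamber_at \<A> B q))) = side H (w (chamber_at \<A> B m))"
      if B: "B \<in> chambers \<A>" for B
    proof (rule sgn_face_sum[of u, OF nonneg mf m(1)])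
      fix q assume "u q \<noteq> 0"
      then have "(m, q) \<in> face_order \<A>"
        by (rule m(2))
      then have "side H (w q) = 0" "q \<in> faces \<A>"
        using True H by (auto simp: face_order_iff)
      then show "side H (w (chamber_at \<A> B q)) = 0 \<or>
          side H (w (chamber_at \<A> B q)) = side H (w (chamber_at \<A> B m))"
        using True by (simp add: side_chamber_at[OF B _ H] mf)
    qed
    show ?thesis
      using *[OF C(1)] *[OF C(2)] by (simp add: face_sum_level fs_eq)
  next
    case False
    then show ?thesis
      by (simp add: side_chamber_at[OF C(1) mf H] side_chamber_at[OF C(2) mf H])
  qed
  then have "chamber_at \<A> C m = chamber_at \<A> C' m"
    using chamber_at_face_side C mf by (intro faces_eqI) auto
  then show False
    using m(1) by (simp add: u_def)
qed

lemma fst_salvetti_map: "fst (salvetti_map (p, C, t)) = face_sum t w"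
  by (simp add: salvetti_map_def vertex_def fst_sum)

lemma snd_salvetti_map:
  "snd (salvetti_map (p, C, t)) = face_sum t w - face_sum t (\<lambda>q. w (chamber_at \<A> C q))"
  by (simp add: salvetti_map_def vertex_def snd_sum scaleR_right_diff_distrib sum_subtractf)

text \<open>Functoriality applied term by term: faces of nonzero weight lie below p, and the
  remaining terms vanish.\<close>

lemma salvetti_map_chamber_at:
  assumes "C \<in> chambers \<A>" "\<And>q. t q \<noteq> 0 \<Longrightarrow> (q, p) \<in> face_order \<A>"
  shows "salvetti_map (p', chamber_at \<A> C p, t) = salvetti_map (p'', C, t)"
  unfolding salvetti_map_def prod.case
proof (rule sum.cong[OF refl])
  show "t q *\<^sub>R vertex (q, chamber_at \<A> (chamber_at \<A> C p) q) = t q *\<^sub>R vertex (q, chamber_at \<A> C q)" for q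
    using chamber_at_chamber_at[OF assms(1,2)] by (cases "t q = 0") auto
qed

section \<open>Gluing classes as fibres\<close>

abbreviation glue_equiv where
  "glue_equiv \<equiv> equivclp (hocolim_glue (face_order \<A>) (D_id_space \<A>) (D_id_map \<A>))"

text \<open>As a member of the support, q lies below p, so one gluing step leads there. For
  \<open>q = p\<close> the gluing relation offers no step, but then C is its own transport.\<close>

lemma glue_normal_form:
  assumes "(p, C, t) \<in> topspace (hocolim_sum (face_order \<A>) (D_id_space \<A>))"
    and "t q \<noteq> 0" "\<And>r. t r \<noteq> 0 \<Longrightarrow> (r, q) \<in> face_order \<A>"
  shows "glue_equiv (p, C, t) (q, chamber_at \<A> C q, t)"
proof (cases "q = p")
  case True
  then show ?thesis
    using assms(1) by (simp add: mem_hocolim_sum_iff chamber_at_id)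
next
  case False
  then have "hocolim_glue (face_order \<A>) (D_id_space \<A>) (D_id_map \<A>) (p, C, t) (q, chamber_at \<A> C q, t)"
    using assms by (auto simp: mem_hocolim_sum_iff hocolim_glue_iff)
  then show ?thesis
    by (rule r_into_equivclp)
qed

lemma glue_equiv_iff:
  assumes a: "a \<in> topspace (hocolim_sum (face_order \<A>) (D_id_space \<A>))"
    and b: "b \<in> topspace (hocolim_sum (face_order \<A>) (D_id_space \<A>))"
  shows "glue_equiv a b \<longleftrightarrow> salvetti_map a = salvetti_map b"
proof
  have glue: "salvetti_map x = salvetti_map y"
    if "hocolim_glue (face_order \<A>) (D_id_space \<A>) (D_id_map \<A>) x y" for x y
  proof -
    from that obtain p q C t where "C \<in> chambers \<A>" "\<And>r. t r \<noteq> 0 \<Longrightarrow> (r, q) \<in> face_order \<A>"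
      "x = (p, C, t)" "y = (q, chamber_at \<A> C q, t)"
      unfolding hocolim_glue_iff by blast
    then show ?thesis
      using salvetti_map_chamber_at[of C t q q p] by simp
  qed
  show "salvetti_map a = salvetti_map b" if "glue_equiv a b"
    using that
  proof (induction rule: equivclp_induct)
    case (step y z)
    then show ?case
      using glue by metis
  qed simp
  show "glue_equiv a b" if eq: "salvetti_map a = salvetti_map b"
  proof -
    obtain p C t p' C' t' where ab: "a = (p, C, t)" "b = (p', C', t')"
      by (metis prod.exhaust)
    note mem = a[unfolded ab mem_hocolim_sum_iff] b[unfolded ab mem_hocolim_sum_iff]
    have fst_eq: "face_sum t w = face_sum t' w"
      using eq fst_salvetti_map ab by metis
    then have t: "t' = t"
      using mem by (intro face_sum_weights_unique) auto
    have snd_eq: "face_sum t (\<lambda>q. w (chamber_at \<A> C q)) = face_sum t (\<lambda>q. w (chamber_at \<A> C' q))"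
      using arg_cong[OF eq, of snd] by (simp add: ab snd_salvetti_map t)
    have "{q. t q \<noteq> 0} \<in> Chains (face_order \<A>)" "{q. t q \<noteq> 0} \<noteq> {}"
      using mem support_nonempty[of t] by simp_all
    then obtain q where q: "t q \<noteq> 0" "\<And>r. t r \<noteq> 0 \<Longrightarrow> (r, q) \<in> face_order \<A>"
      using support_greatest by metis
    \<comment> \<open>A normal form records only t and the chamber over the greatest face q of its
      support, so agreement at q is enough.\<close>
    have "chamber_at \<A> C q = chamber_at \<A> C' q"
      using mem q(1) snd_eq by (intro face_sum_chambers_unique[of t C C']) auto
    moreover have "glue_equiv a (q, chamber_at \<A> C q, t)"
      unfolding ab using a q by (intro glue_normal_form) (auto simp: ab)
    moreover have "glue_equiv b (q, chamber_at \<A> C' q, t)"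
      unfolding ab t using b q by (intro glue_normal_form) (auto simp: ab t)
    ultimately show ?thesis
      by (metis equivclp_sym equivclp_trans)
  qed
qed

lemma salvetti_map_image:
  "salvetti_map ` topspace (hocolim_sum (face_order \<A>) (D_id_space \<A>)) = (\<Union>\<sigma>\<in>Sal \<A> w. convex hull \<sigma>)"
proof
  show "salvetti_map ` topspace (hocolim_sum (face_order \<A>) (D_id_space \<A>)) \<subseteq> (\<Union>\<sigma>\<in>Sal \<A> w. convex hull \<sigma>)"
  proof
    fix x assume "x \<in> salvetti_map ` topspace (hocolim_sum (face_order \<A>) (D_id_space \<A>))"
    then obtain p C t where x: "x = salvetti_map (p, C, t)"
      and "(p, C, t) \<in> topspace (hocolim_sum (face_order \<A>) (D_id_space \<A>))"
      by auto
    then have mem: "C \<in> chambers \<A>" "\<And>q. 0 \<le> t q" "{q. t q \<noteq> 0} \<in> Chains (face_order \<A>)" "sum t (faces \<A>) = 1"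
      by (auto simp: mem_hocolim_sum_iff)
    define S where "S = {q. t q \<noteq> 0}"
    have S: "S \<in> Chains (face_order \<A>)" "S \<subseteq> faces \<A>" "finite S"
      using mem(3) Chains_faces finite_Chains by (auto simp: S_def)
    have sum_S: "sum t S = 1"
      using sum.mono_neutral_right[OF finite_faces S(2), of t] mem(4) by (auto simp: S_def)
    then have "S \<noteq> {}"
      by force
    let ?\<sigma> = "vertex ` (\<lambda>q. (q, chamber_at \<A> C q)) ` S"
    have "?\<sigma> \<in> Sal \<A> w"
      unfolding Sal_eq order_complex_Plim using mem(1) S(1) \<open>S \<noteq> {}\<close> by blast
    moreover have "x = (\<Sum>q\<in>S. t q *\<^sub>R vertex (q, chamber_at \<A> C q))"
      unfolding x salvetti_map_def prod.case using S finite_faces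
      by (intro sum.mono_neutral_right) (auto simp: S_def)
    then have "x \<in> convex hull ?\<sigma>"
      using S(3) sum_S mem(2) by (simp add: convex_sum[OF _ convex_convex_hull] hull_inc)
    ultimately show "x \<in> (\<Union>\<sigma>\<in>Sal \<A> w. convex hull \<sigma>)"
      by blast
  qed
  show "(\<Union>\<sigma>\<in>Sal \<A> w. convex hull \<sigma>) \<subseteq> salvetti_map ` topspace (hocolim_sum (face_order \<A>) (D_id_space \<A>))"
  proof
    fix x assume "x \<in> (\<Union>\<sigma>\<in>Sal \<A> w. convex hull \<sigma>)"
    then obtain C S where S: "C \<in> chambers \<A>" "S \<in> Chains (face_order \<A>)" "S \<noteq> {}"
      and "x \<in> convex hull vertex ` (\<lambda>q. (q, chamber_at \<A> C q)) ` S"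
      unfolding Sal_eq order_complex_Plim by blast
    then have x: "x \<in> convex hull (\<lambda>q. vertex (q, chamber_at \<A> C q)) ` S"
      by (simp only: image_image)
    note S_faces = Chains_faces[OF S(2)] and S_finite = finite_Chains[OF S(2)]
    let ?v = "\<lambda>q. vertex (q, chamber_at \<A> C q)"
    have inj: "inj_on ?v S"
      using S_faces w_inj by (auto simp: inj_on_def vertex_def)
    obtain u where u: "\<And>y. y \<in> ?v ` S \<Longrightarrow> 0 \<le> u y" "sum u (?v ` S) = 1"
      "(\<Sum>y\<in>?v ` S. u y *\<^sub>R y) = x"
      using x[unfolded convex_hull_finite[OF finite_imageI[OF S_finite]]] by blast
    \<comment> \<open>Distinct faces of S have distinct vertices, so each hull coefficient belongs
      to one face. Some may be 0; taking the index face p greatest in S bounds the support in any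
      case.\<close>
    define t where "t q = (if q \<in> S then u (?v q) else 0)" for q
    obtain p where p: "p \<in> S" "\<And>q. q \<in> S \<Longrightarrow> (q, p) \<in> face_order \<A>"
      using finite_chain_greatest[OF S_finite S(3,2) trans_face_order] by blast
    have p_face: "p \<in> faces \<A>"
      using p(1) S_faces by blast
    have t_nonneg: "0 \<le> t q" for q
      using u(1) by (simp add: t_def)
    have t_supp: "q \<in> S" if "t q \<noteq> 0" for q
      using that by (auto simp: t_def split: if_splits)
    have "sum t (faces \<A>) = sum t S"
      using t_supp S_faces finite_faces by (intro sum.mono_neutral_right) auto
    also have "\<dots> = 1"
      using u(2) by (simp add: sum.reindex[OF inj] t_def)
    finally have "sum t (faces \<A>) = 1" .
    moreover have "{q. t q \<noteq> 0} \<in> Chains (face_order \<A>)"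
      using S(2) t_supp unfolding Chains_def by blast
    ultimately have "(p, chamber_at \<A> C p, t) \<in> topspace (hocolim_sum (face_order \<A>) (D_id_space \<A>))"
      unfolding mem_hocolim_sum_iff using t_supp p p_face t_nonneg S(1)
      by (simp add: chamber_at_chamber chamber_at_le)
    moreover have "salvetti_map (p, chamber_at \<A> C p, t) = x"
    proof -
      have "salvetti_map (p, chamber_at \<A> C p, t) = salvetti_map (p, C, t)"
        using S(1) p t_supp by (intro salvetti_map_chamber_at) auto
      also have "\<dots> = (\<Sum>q\<in>S. t q *\<^sub>R ?v q)"
        unfolding salvetti_map_def prod.case using t_supp S_faces finite_faces
        by (intro sum.mono_neutral_right) auto
      also have "\<dots> = x"
        unfolding u(3)[symmetric] by (simp add: sum.reindex[OF inj] t_def)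
      finally show ?thesis .
    qed
    ultimately show "x \<in> salvetti_map ` topspace (hocolim_sum (face_order \<A>) (D_id_space \<A>))"
      by blast
  qed
qed

section \<open>Compactness, continuity and the resulting quotient map\<close>

lemma compact_space_hocolim_sum: "compact_space (hocolim_sum (face_order \<A>) (D_id_space \<A>))"
  unfolding hocolim_sum_def Field_face_order
proof (rule compact_space_sum_topology[OF finite_faces])
  fix p
  let ?K = "order_complex (Restr (face_order \<A>) (under (face_order \<A>) p))"
  have "?K \<subseteq> Pow (faces \<A>)"
  proof
    fix S assume "S \<in> ?K"
    then have "S \<in> Chains (face_order \<A>)"
      unfolding order_complex_under_iff by blast
    then show "S \<in> Pow (faces \<A>)"
      using Chains_faces by simp
  qed
  then have "finite ?K"
    using finite_faces by (simp add: finite_subset)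
  moreover have "finite \<sigma>" if "\<sigma> \<in> ?K" for \<sigma>
    using that by (simp add: order_complex_def)
  moreover have "\<tau> \<in> ?K" if "\<sigma> \<in> ?K" "\<tau> \<subseteq> \<sigma>" "\<tau> \<noteq> {}" for \<sigma> \<tau>
    using that unfolding order_complex_under_iff Chains_def by blast
  ultimately have "compact_space (realization ?K)"
    by (rule compact_space_realization)
  moreover have "finite (topspace (D_id_space \<A> p))"
    using finite_subset[OF _ finite_faces] chamber_face by (auto simp: D_id_space_def subset_iff)
  then have "compact_space (D_id_space \<A> p)"
    by (simp add: D_id_space_def compact_space_discrete_topology)
  ultimately show "compact_space (prod_topology (D_id_space \<A> p) (realization ?K))"
    by (simp add: compact_space_prod_topology)
qed

text \<open>Index face and chamber are discrete parameters; with both fixed, the value is a finite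
  linear combination of coordinates of t.\<close>

lemma continuous_map_salvetti_map:
  "continuous_map (hocolim_sum (face_order \<A>) (D_id_space \<A>)) euclidean salvetti_map"
  unfolding hocolim_sum_def D_id_space_def
proof (intro continuous_map_from_sum_topology continuous_map_from_discrete_prod)
  fix p C
  have "continuous_on T (\<lambda>t. face_sum t (\<lambda>q. vertex (q, chamber_at \<A> C q)))" for T :: "('a set \<Rightarrow> real) set"
    by (intro continuous_intros continuous_on_subset[OF continuous_on_product_coordinates]) simp
  then show "continuous_map (realization (order_complex (Restr (face_order \<A>) (under (face_order \<A>) p))))
      euclidean (\<lambda>t. salvetti_map (p, C, t))"
    by (simp add: salvetti_map_def realization_def)
qed

lemma quotient_map_salvetti_map:
  "quotient_map (hocolim_sum (face_order \<A>) (D_id_space \<A>)) (Sal_space \<A> w) salvetti_map"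
proof (rule continuous_imp_quotient_map)
  show "continuous_map (hocolim_sum (face_order \<A>) (D_id_space \<A>)) (Sal_space \<A> w) salvetti_map"
    unfolding Sal_space_def
    using continuous_map_salvetti_map salvetti_map_image by (auto simp: continuous_map_in_subtopology)
  show "Hausdorff_space (Sal_space \<A> w)"
    by (simp add: Sal_space_def Hausdorff_space_subtopology)
  show "salvetti_map ` topspace (hocolim_sum (face_order \<A>) (D_id_space \<A>)) = topspace (Sal_space \<A> w)"
    by (simp add: Sal_space_def salvetti_map_image)
qed (rule compact_space_hocolim_sum)

lemma hocolim_homeomorphic_Sal_space:
  "hocolim (face_order \<A>) (D_id_space \<A>) (D_id_map \<A>) homeomorphic_space Sal_space \<A> w"
proof -
  have "{(a, b). a \<in> topspace (hocolim_sum (face_order \<A>) (D_id_space \<A>)) \<and>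
      b \<in> topspace (hocolim_sum (face_order \<A>) (D_id_space \<A>)) \<and> glue_equiv a b} =
    {(a, b). a \<in> topspace (hocolim_sum (face_order \<A>) (D_id_space \<A>)) \<and>
      b \<in> topspace (hocolim_sum (face_order \<A>) (D_id_space \<A>)) \<and> salvetti_map a = salvetti_map b}"
    using glue_equiv_iff by blast
  then show ?thesis
    unfolding hocolim_def
    by (simp only: homeomorphic_space_quotient_topology[OF quotient_map_salvetti_map])
qed

end

theorem proposition4p2:
  fixes \<A> :: "(real ^ 'd) set set" and w :: "(real ^ 'd) set \<Rightarrow> real ^ 'd"
  assumes "arrangement \<A>"
    and "\<forall>F\<in>faces \<A>. w F \<in> F"
  shows "hocolim (face_order \<A>) (D_id_space \<A>) (D_id_map \<A>) homotopy_equivalent_space Sal_space \<A> w \<and>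
    simplicially_isomorphic
      (order_complex (Plim (face_order \<A>) (D_id_space \<A>) (D_id_map \<A>))) (Sal \<A> w)"
proof -
  interpret pointed_arrangement \<A> w
    using assms by unfold_locales
  show ?thesis
    using homeomorphic_imp_homotopy_equivalent_space[OF hocolim_homeomorphic_Sal_space]
      Plim_simplicially_isomorphic_Sal by blast
qed

end
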